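(* Let $2 \leq m \leq n$ be integers and let $P_m, P_n$ denote the paths on $m$ and $n$ vertices. If $m, n \leq 3$ then $\sigma(P_m \,\Box\, P_n) = 2$; otherwise $\sigma(P_m \,\Box\, P_n) = 3$.
   Context: Surrounding Cops and Robbers on a finite simple graph $G$ with $k \geq 1$ cops and one robber: the cops first choose starting vertices (several cops may share a vertex), then the robber chooses a starting vertex not occupied by a cop, and thereafter the cops and the robber alternate moves, the cops moving first. In a move, each player may move to an adjacent vertex or stay put; the robber may never move to, or remain on, a vertex occupied by a cop, so if a cop moves onto the robber's vertex the robber is compelled to move to a neighbouring vertex not occupied by a cop. The cops win if at any time every neighbour of the robber's vertex is occupied by a cop; the robber wins if he avoids this forever. Play is with perfect information. The surrounding cop number $\sigma(G)$ is the least number of cops for which the cops have a winning strategy. $\Box$ denotes the Cartesian product of graphs: $(g,h)\sim(g',h')$ iff either $g=g'$ and $h\sim h'$, or $h=h'$ and $g\sim g'$. *)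

theory Defs
  imports "Graph_Theory.Pair_Digraph"
begin

text \<open>
  A finite simple graph is a \<^locale>\<open>pair_graph\<close>: a finite vertex set with a symmetric,
  irreflexive set of arcs, each edge \<open>uv\<close> being represented by both arcs \<open>(u, v)\<close> and \<open>(v, u)\<close>.
\<close>

definition path_graph :: "nat \<Rightarrow> nat pair_pre_digraph" where
  "path_graph n =
    \<lparr> pverts = {0..<n},
      parcs = {(i, j). i < n \<and> j < n \<and> (j = Suc i \<or> i = Suc j)} \<rparr>"

definition cartesian_product ::
    "'a pair_pre_digraph \<Rightarrow> 'b pair_pre_digraph \<Rightarrow> ('a \<times> 'b) pair_pre_digraph"
    (infixl "\<box>" 70) where
  "G \<box> H =
    \<lparr> pverts = pverts G \<times> pverts H,
      parcs = {((g, h), (g', h')).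
        (g = g' \<and> g \<in> pverts G \<and> (h, h') \<in> parcs H) \<or>
        (h = h' \<and> h \<in> pverts H \<and> (g, g') \<in> parcs G)} \<rparr>"

definition move :: "'a pair_pre_digraph \<Rightarrow> 'a \<Rightarrow> 'a \<Rightarrow> bool" where
  "move G u v \<longleftrightarrow> v = u \<or> (u, v) \<in> parcs G"

text \<open>The \<open>i\<close>-th entry of the list \<open>cs\<close> is the vertex of the \<open>i\<close>-th cop.\<close>

definition surrounded :: "'a pair_pre_digraph \<Rightarrow> 'a list \<Rightarrow> 'a \<Rightarrow> bool" where
  "surrounded G cs r \<longleftrightarrow> (\<forall>v. (r, v) \<in> parcs G \<longrightarrow> v \<in> set cs)"

text \<open>
  A strategy of the cops maps the list of vertices visited by the robber so far to the next
  position of the cops; \<open>S []\<close> is their initial placement. No generality is lost by omitting the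
  cops' own earlier positions from the argument, as \<open>S\<close> determines them. Legality is required for
  all lists, also those that do not arise in a play; there the cops may simply stay put.
\<close>

definition cop_strategy :: "'a pair_pre_digraph \<Rightarrow> nat \<Rightarrow> ('a list \<Rightarrow> 'a list) \<Rightarrow> bool" where
  "cop_strategy G k S \<longleftrightarrow>
    length (S []) = k \<and> set (S []) \<subseteq> pverts G \<and>
    (\<forall>rs r. list_all2 (move G) (S rs) (S (rs @ [r])))"

text \<open>
  If the cops follow \<open>S\<close> and the robber visits \<open>R 0, R 1, \<dots>\<close>, then \<open>cops_at S R t\<close> is the position
  of the cops when the robber moves to \<open>R t\<close> (chooses \<open>R 0\<close> initially, if \<open>t = 0\<close>); thereafter
  they move to \<open>cops_at S R (Suc t)\<close>.
\<close>

definition cops_at :: "('a list \<Rightarrow> 'a list) \<Rightarrow> (nat \<Rightarrow> 'a) \<Rightarrow> nat \<Rightarrow> 'a list" where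
  "cops_at S R t = S (map R [0..<t])"

definition robber_play :: "'a pair_pre_digraph \<Rightarrow> ('a list \<Rightarrow> 'a list) \<Rightarrow> (nat \<Rightarrow> 'a) \<Rightarrow> bool" where
  "robber_play G S R \<longleftrightarrow>
    R 0 \<in> pverts G \<and>
    (\<forall>t. move G (R t) (R (Suc t))) \<and>
    (\<forall>t. R t \<notin> set (cops_at S R t))"

text \<open>
  The robber wins a play iff it goes on forever and he is surrounded neither after a move of his
  own nor after a move of the cops. A robber who is not surrounded always has a legal move, so
  every other play ends with the robber surrounded.
\<close>

definition robber_wins :: "'a pair_pre_digraph \<Rightarrow> ('a list \<Rightarrow> 'a list) \<Rightarrow> (nat \<Rightarrow> 'a) \<Rightarrow> bool" where
  "robber_wins G S R \<longleftrightarrow>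
    robber_play G S R \<and>
    (\<forall>t. \<not> surrounded G (cops_at S R t) (R t) \<and>
         \<not> surrounded G (cops_at S R (Suc t)) (R t))"

definition cops_win :: "'a pair_pre_digraph \<Rightarrow> nat \<Rightarrow> bool" where
  "cops_win G k \<longleftrightarrow> (\<exists>S. cop_strategy G k S \<and> \<not> (\<exists>R. robber_wins G S R))"

definition surrounding_cop_number :: "'a pair_pre_digraph \<Rightarrow> nat" where
  "surrounding_cop_number G = (LEAST k. 1 \<le> k \<and> cops_win G k)"

text \<open>The minimum is attained: cops on all vertices leave the robber no starting vertex.\<close>

lemma ex_cops_win:
  assumes "finite (pverts G)" and "pverts G \<noteq> {}"
  shows "\<exists>k\<ge>1. cops_win G k"
proof -
  obtain xs where xs: "set xs = pverts G"
    using finite_list[OF assms(1)] by blast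
  have "cop_strategy G (length xs) (\<lambda>_. xs)"
    by (auto simp: cop_strategy_def xs move_def intro: list.rel_refl)
  moreover have "\<not> robber_wins G (\<lambda>_. xs) R" for R
    by (auto simp: robber_wins_def robber_play_def cops_at_def xs)
  ultimately have "cops_win G (length xs)"
    unfolding cops_win_def by blast
  moreover have "1 \<le> length xs"
    using xs assms(2) by (cases xs) auto
  ultimately show ?thesis by blast
qed

lemma pair_graph_path_graph: "pair_graph (path_graph n)"
proof -
  have "parcs (path_graph n) \<subseteq> {0..<n} \<times> {0..<n}"
    by (auto simp: path_graph_def)
  then have "finite (parcs (path_graph n))"
    by (rule finite_subset) simp
  then show ?thesis
    by unfold_locales (auto simp: path_graph_def symmetric_def sym_def)
qed

lemma pair_graph_cartesian_product:
  assumes "pair_graph G" and "pair_graph H"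
  shows "pair_graph (G \<box> H)"
proof -
  interpret G: pair_graph G by fact
  interpret H: pair_graph H by fact
  have wf: "parcs (G \<box> H) \<subseteq> pverts (G \<box> H) \<times> pverts (G \<box> H)"
    by (auto simp: cartesian_product_def dest: G.arc_fst_in_verts G.arc_snd_in_verts
        H.arc_fst_in_verts H.arc_snd_in_verts)
  have fin: "finite (pverts (G \<box> H))"
    by (simp add: cartesian_product_def G.pair_finite_verts H.pair_finite_verts)
  have "sym (parcs G)" and "sym (parcs H)"
    using G.pair_sym_arcs H.pair_sym_arcs by (simp_all add: symmetric_def)
  then have "sym (parcs (G \<box> H))"
    by (auto simp: cartesian_product_def sym_def)
  moreover have "fst e \<noteq> snd e" if "e \<in> parcs (G \<box> H)" for e
    using that G.pair_no_loops H.pair_no_loops by (fastforce simp: cartesian_product_def)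
  moreover have "finite (parcs (G \<box> H))"
    using finite_subset[OF wf] fin by simp
  ultimately show ?thesis
    using wf fin by unfold_locales (auto simp: symmetric_def)
qed

end

theory Submission
  imports Defs
begin

text \<open>
  A robber who keeps to vertices of degree greater than the number of cops is never surrounded there;
  for two cops and \<open>n \<ge> 4\<close> the columns \<open>1, \<dots>, n - 2\<close> consist of such vertices and induce a
  subgraph of minimum degree two, so he never has to leave them.

  Three cops win as follows. Starting in a corner, one of them reaches the robber's column and another
  his row, on the side of that corner, and they keep level with him. If the robber moves towards
  either of them, the distance between the two shrinks for good, and if he rests, both close in. Once
  both are adjacent to him he can only rest or move away from their corner; the third cop walks onto
  him whenever he rests, which drives him into the opposite corner, where he is surrounded.
\<close>

section \<open>Potential arguments for the cops\<close>

text \<open>A strategy sees only the robber's history, here newest vertex first. The cops' position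
  is recomputed from it, so that \<open>g\<close> may depend on that position and on the robber's
  last two vertices.\<close>

fun follow :: "'b \<Rightarrow> ('a \<Rightarrow> 'b) \<Rightarrow> ('b \<Rightarrow> 'a \<Rightarrow> 'a \<Rightarrow> 'b) \<Rightarrow> 'a list \<Rightarrow> 'b" where
  "follow c\<^sub>0 f g [] = c\<^sub>0"
| "follow c\<^sub>0 f g [r] = f r"
| "follow c\<^sub>0 f g (r' # r # rs) = g (follow c\<^sub>0 f g (r # rs)) r r'"

text \<open>\<open>J\<close> is an invariant of the positions in which it is the robber's turn.\<close>

lemma cops_win_by_potential:
  fixes G :: "'a pair_pre_digraph" and J :: "'a list \<Rightarrow> 'a \<Rightarrow> bool"
  assumes cs\<^sub>0: "length cs\<^sub>0 = k" "set cs\<^sub>0 \<subseteq> pverts G"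
    and wf: "wf \<Delta>"
    and start: "\<And>r. r \<in> pverts G \<Longrightarrow> r \<notin> set cs\<^sub>0 \<Longrightarrow>
      \<exists>cs. list_all2 (move G) cs\<^sub>0 cs \<and> (surrounded G cs r \<or> J cs r)"
    and step: "\<And>cs r r'. J cs r \<Longrightarrow> move G r r' \<Longrightarrow> r' \<notin> set cs \<Longrightarrow>
      \<exists>cs'. list_all2 (move G) cs cs' \<and>
        (surrounded G cs' r' \<or> J cs' r' \<and> ((cs', r'), (cs, r)) \<in> \<Delta>)"
  shows "cops_win G k"
proof -
  \<comment> \<open>Where no suitable reply exists the cops stay put, which keeps the strategy legal
    on histories that no play produces.\<close>
  define pick where "pick cs P =
      (if \<exists>cs'. list_all2 (move G) cs cs' \<and> P cs'
       then SOME cs'. list_all2 (move G) cs cs' \<and> P cs' else cs)" for cs P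
  have stay: "list_all2 (move G) cs cs" for cs
    by (rule list.rel_refl) (simp add: move_def)
  have pick_move: "list_all2 (move G) cs (pick cs P)" for cs P
  proof (cases "\<exists>cs'. list_all2 (move G) cs cs' \<and> P cs'")
    case True
    from someI_ex[OF this] True show ?thesis by (simp add: pick_def)
  qed (simp only: pick_def stay if_False)
  have pick_prop: "P (pick cs P)" if "\<exists>cs'. list_all2 (move G) cs cs' \<and> P cs'" for cs P
    unfolding pick_def using that someI_ex[OF that] by simp
  define f where "f r = pick cs\<^sub>0 (\<lambda>cs. surrounded G cs r \<or> J cs r)" for r
  define g where "g cs r r' = pick cs (\<lambda>cs'. surrounded G cs' r' \<or>
      J cs' r' \<and> ((cs', r'), (cs, r)) \<in> \<Delta>)" for cs r r'
  define S where "S rs = follow cs\<^sub>0 f g (rev rs)" for rs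
  have legal: "list_all2 (move G) (S rs) (S (rs @ [r]))" for rs r
    by (cases "rev rs") (auto simp: S_def f_def g_def pick_move)
  have S: "cop_strategy G k S"
    using cs\<^sub>0 legal by (auto simp: cop_strategy_def S_def)
  have "\<not> robber_wins G S R" for R
  proof
    assume "robber_wins G S R"
    then have R0: "R 0 \<in> pverts G" and mv: "move G (R t) (R (Suc t))"
      and free: "R t \<notin> set (cops_at S R t)"
      and uns: "\<not> surrounded G (cops_at S R (Suc t)) (R t)" for t
      by (auto simp: robber_wins_def robber_play_def)
    have c0: "cops_at S R 0 = cs\<^sub>0" and c1: "cops_at S R (Suc 0) = f (R 0)"
      by (simp_all add: cops_at_def S_def)
    have c2: "cops_at S R (Suc (Suc t)) = g (cops_at S R (Suc t)) (R t) (R (Suc t))" for t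
      by (simp add: cops_at_def S_def)
    have J0: "J (cops_at S R (Suc 0)) (R 0)"
      using pick_prop[OF start[OF R0]] free[of 0] uns[of 0] by (auto simp: c0 c1 f_def)
    have JS: "J (cops_at S R (Suc (Suc t))) (R (Suc t)) \<and>
        ((cops_at S R (Suc (Suc t)), R (Suc t)), (cops_at S R (Suc t), R t)) \<in> \<Delta>"
      if "J (cops_at S R (Suc t)) (R t)" for t
      using pick_prop[OF step[OF that mv free]] uns[of "Suc t"] by (auto simp: c2 g_def)
    have "J (cops_at S R (Suc t)) (R t)" for t
      by (induction t) (use J0 JS in auto)
    with JS have "\<forall>t. ((cops_at S R (Suc (Suc t)), R (Suc t)), (cops_at S R (Suc t), R t)) \<in> \<Delta>"
      by blast
    then have "\<exists>\<phi>. \<forall>t. (\<phi> (Suc t), \<phi> t) \<in> \<Delta>"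
      by (intro exI[of _ "\<lambda>t. (cops_at S R (Suc t), R t)"])
    with wf show False
      unfolding wf_iff_no_infinite_down_chain by blast
  qed
  with S show ?thesis
    unfolding cops_win_def by blast
qed

section \<open>Evasion by the robber\<close>

text \<open>
  The robber stays inside \<open>A\<close> and moves only when a cop has stepped onto his vertex; then at most
  \<open>k - 1\<close> of his neighbours are occupied.
\<close>

lemma not_cops_win_if_evasion_set:
  assumes G: "pair_graph G" and A: "A \<subseteq> pverts G" "k < card A"
    and deg: "\<And>u. u \<in> A \<Longrightarrow> k < card {v. (u, v) \<in> parcs G}"
    and degA: "\<And>u. u \<in> A \<Longrightarrow> k \<le> card {v \<in> A. (u, v) \<in> parcs G}"
  shows "\<not> cops_win G k"
proof
  interpret pair_graph G by fact
  assume "cops_win G k"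
  then obtain S where S: "cop_strategy G k S" and lose: "\<And>R. \<not> robber_wins G S R"
    unfolding cops_win_def by blast
  have len: "length (S rs) = k" for rs
  proof (induction rs rule: rev_induct)
    case (snoc r rs)
    then show ?case
      using S list_all2_lengthD unfolding cop_strategy_def by metis
  qed (use S in \<open>simp add: cop_strategy_def\<close>)
  have card: "card (set (S rs)) \<le> k" for rs
    using card_length[of "S rs"] len by simp
  have unsurrounded: "\<not> surrounded G (S rs) u" if "u \<in> A" for rs u
  proof
    assume "surrounded G (S rs) u"
    then have "{v. (u, v) \<in> parcs G} \<subseteq> set (S rs)"
      by (auto simp: surrounded_def)
    from card_mono[OF _ this] show False
      using deg[OF that] card[of rs] by simp
  qed
  have "\<exists>v \<in> A. move G u v \<and> v \<notin> set (S rs)" if u: "u \<in> A" for u rs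
  proof (cases "u \<in> set (S rs)")
    case True
    have "u \<notin> {v \<in> A. (u, v) \<in> parcs G}"
      using pair_no_loops[of "(u, u)"] by auto
    then have "\<not> {v \<in> A. (u, v) \<in> parcs G} \<subseteq> set (S rs)" (is "\<not> ?N \<subseteq> _")
    proof (intro notI)
      assume "u \<notin> ?N" "?N \<subseteq> set (S rs)"
      with True have "?N \<subset> set (S rs)" by blast
      from psubset_card_mono[OF _ this] show False
        using degA[OF u] card[of rs] by simp
    qed
    then show ?thesis by (auto simp: move_def)
  qed (use u in \<open>auto simp: move_def\<close>)
  then obtain e where e: "e u rs \<in> A" "move G u (e u rs)" "e u rs \<notin> set (S rs)"
    if "u \<in> A" for u rs by metis
  have "\<not> A \<subseteq> set (S [])"
    using card_mono[of "set (S [])" A] A(2) card[of "[]"] by auto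
  then obtain r\<^sub>0 where r\<^sub>0: "r\<^sub>0 \<in> A" "r\<^sub>0 \<notin> set (S [])" by blast
  \<comment> \<open>\<open>H t\<close> is the robber's history up to time \<open>t\<close>; his next
    vertex avoids \<open>S (H t)\<close>, the cops' position at time \<open>Suc t\<close>.\<close>
  define H where "H = rec_nat [r\<^sub>0] (\<lambda>_ rs. rs @ [e (last rs) rs])"
  have H: "H 0 = [r\<^sub>0]" "H (Suc t) = H t @ [e (last (H t)) (H t)]" for t
    by (simp_all add: H_def)
  define R where "R t = last (H t)" for t
  have R: "R 0 = r\<^sub>0" "R (Suc t) = e (R t) (H t)" for t
    by (simp_all add: R_def H)
  have hist: "map R [0..<Suc t] = H t" for t
    by (induction t) (simp_all add: H R R_def[symmetric])
  have RA: "R t \<in> A" for t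
    by (induction t) (simp_all add: R r\<^sub>0 e)
  have "R t \<notin> set (S (map R [0..<t]))" for t
  proof (cases t)
    case (Suc s)
    then show ?thesis
      using e(3)[OF RA[of s]] by (simp only: hist R) simp
  qed (simp add: R r\<^sub>0)
  then have "robber_wins G S R"
    using RA A(1) unsurrounded e(2)[OF RA] R
    by (auto simp: robber_wins_def robber_play_def cops_at_def simp del: upt_Suc)
  with lose show False by blast
qed

section \<open>Grids\<close>

lemma parcs_grid_iff:
  "((i, j), (i', j')) \<in> parcs (path_graph m \<box> path_graph n) \<longleftrightarrow>
     i < m \<and> j < n \<and> i' < m \<and> j' < n \<and>
     (i' = i \<and> (j' = Suc j \<or> j = Suc j') \<or> j' = j \<and> (i' = Suc i \<or> i = Suc i'))"
  by (auto simp: cartesian_product_def path_graph_def)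

lemma pverts_grid: "pverts (path_graph m \<box> path_graph n) = {0..<m} \<times> {0..<n}"
  by (simp add: cartesian_product_def path_graph_def)

lemma pair_graph_grid: "pair_graph (path_graph m \<box> path_graph n)"
  by (intro pair_graph_cartesian_product pair_graph_path_graph)

lemma finite_nbrs_grid: "finite {v. (u, v) \<in> parcs (path_graph m \<box> path_graph n)}"
  by (rule finite_subset[of _ "{0..<m} \<times> {0..<n}"]) (cases u; auto simp: parcs_grid_iff)+

text \<open>The whole grid is an evasion set for one cop, since each vertex has a neighbour in its
  row and another in its column.\<close>

lemma one_cop_loses_grid:
  assumes "2 \<le> m" "2 \<le> n"
  shows "\<not> cops_win (path_graph m \<box> path_graph n) 1"
proof (rule not_cops_win_if_evasion_set[OF pair_graph_grid])
  let ?G = "path_graph m \<box> path_graph n"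
  have "2 * 2 \<le> m * n"
    using assms by (intro mult_le_mono)
  then show "1 < card (pverts ?G)"
    by (simp add: pverts_grid)
  show deg: "1 < card {v. (u, v) \<in> parcs ?G}" if "u \<in> pverts ?G" for u
  proof -
    obtain i j where u: "u = (i, j)" "i < m" "j < n"
      using \<open>u \<in> pverts ?G\<close> by (auto simp: pverts_grid)
    have "{(if i = 0 then 1 else i - 1, j), (i, if j = 0 then 1 else j - 1)}
        \<subseteq> {v. (u, v) \<in> parcs ?G}" (is "?X \<subseteq> _")
      using u assms by (auto simp: parcs_grid_iff)
    then have "card ?X \<le> card {v. (u, v) \<in> parcs ?G}"
      by (intro card_mono finite_nbrs_grid)
    moreover have "card ?X = 2"
      by (auto simp: card_insert_if)
    ultimately show ?thesis by simp
  qed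
  show "1 \<le> card {v \<in> pverts ?G. (u, v) \<in> parcs ?G}" if "u \<in> pverts ?G" for u
  proof -
    have "{v \<in> pverts ?G. (u, v) \<in> parcs ?G} = {v. (u, v) \<in> parcs ?G}"
      by (cases u) (auto simp: parcs_grid_iff pverts_grid)
    with deg[OF that] show ?thesis by simp
  qed
qed simp

lemma two_cops_lose_grid:
  assumes "2 \<le> m" "4 \<le> n"
  shows "\<not> cops_win (path_graph m \<box> path_graph n) 2"
proof (rule not_cops_win_if_evasion_set[OF pair_graph_grid])
  let ?G = "path_graph m \<box> path_graph n"
  let ?A = "{0..<m} \<times> {1..<n - 1}"
  show "?A \<subseteq> pverts ?G"
    by (auto simp: pverts_grid)
  have "2 * 2 \<le> m * (n - 2)"
    using assms by (intro mult_le_mono) auto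
  then show "2 < card ?A" by (simp add: numeral_2_eq_2)
  fix u assume "u \<in> ?A"
  then obtain i j where u: "u = (i, j)" "i < m" "1 \<le> j" "j < n - 1"
    by auto
  \<comment> \<open>The value 2 of \<open>?j\<close> at \<open>j = 1\<close> stays inside
    \<open>?A\<close> because \<open>n\<close> is at least 4.\<close>
  let ?i = "if i = 0 then 1 else i - 1" and ?j = "if j = 1 then 2 else j - 1"
  have "{(?i, j), (i, j - 1), (i, j + 1)} \<subseteq> {v. (u, v) \<in> parcs ?G}" (is "?X \<subseteq> _")
    using u assms by (auto simp: parcs_grid_iff)
  then have "card ?X \<le> card {v. (u, v) \<in> parcs ?G}"
    by (intro card_mono finite_nbrs_grid)
  moreover have "card ?X = 3"
    using u by (auto simp: card_insert_if)
  ultimately show "2 < card {v. (u, v) \<in> parcs ?G}" by simp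
  have "{(?i, j), (i, ?j)} \<subseteq> {v \<in> ?A. (u, v) \<in> parcs ?G}" (is "?Y \<subseteq> _")
    using u assms by (auto simp: parcs_grid_iff)
  then have "card ?Y \<le> card {v \<in> ?A. (u, v) \<in> parcs ?G}"
    by (intro card_mono) (use finite_nbrs_grid in auto)
  moreover have "card ?Y = 2"
    by (auto simp: card_insert_if)
  ultimately show "2 \<le> card {v \<in> ?A. (u, v) \<in> parcs ?G}" by simp
qed

section \<open>Two cops on small grids\<close>

lemma cops_win_if_surrounded_at_once:
  assumes "length cs\<^sub>0 = k" "set cs\<^sub>0 \<subseteq> pverts G"
    and "\<And>r. r \<in> pverts G \<Longrightarrow> r \<notin> set cs\<^sub>0 \<Longrightarrow>
      \<exists>cs. list_all2 (move G) cs\<^sub>0 cs \<and> surrounded G cs r"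
  shows "cops_win G k"
  by (rule cops_win_by_potential[where J = "\<lambda>_ _. False" and \<Delta> = "{}", OF assms(1,2)])
    (use assms(3) in auto)

text \<open>The cops sit still on opposite corners, which form the neighbourhood of either remaining
  vertex.\<close>

lemma two_cops_win_grid_2_2: "cops_win (path_graph 2 \<box> path_graph 2) 2"
proof (rule cops_win_if_surrounded_at_once)
  let ?G = "path_graph 2 \<box> path_graph 2" and ?cs = "[(0, 0), (1, 1)] :: (nat \<times> nat) list"
  fix r assume "r \<in> pverts ?G" "r \<notin> set ?cs"
  then have "list_all2 (move ?G) ?cs ?cs \<and> surrounded ?G ?cs r"
    by (auto simp: pverts_grid move_def surrounded_def parcs_grid_iff less_Suc_eq numeral_eq_Suc)
  then show "\<exists>cs. list_all2 (move ?G) ?cs cs \<and> surrounded ?G cs r" ..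
qed (auto simp: pverts_grid)

text \<open>The cops hold the middle column, leaving the robber a corner; the cop in his row stays
  and the other steps into his column.\<close>

lemma two_cops_win_grid_2_3: "cops_win (path_graph 2 \<box> path_graph 3) 2"
proof (rule cops_win_if_surrounded_at_once)
  let ?G = "path_graph 2 \<box> path_graph 3" and ?cs = "[(0, 1), (1, 1)] :: (nat \<times> nat) list"
  fix r assume "r \<in> pverts ?G" "r \<notin> set ?cs"
  then obtain i j where r: "r = (i, j)" "i = 0 \<or> i = 1" "j = 0 \<or> j = 2"
    by (auto simp: pverts_grid less_Suc_eq numeral_eq_Suc)
  have "list_all2 (move ?G) ?cs (if i = 0 then [(0, 1), (1, j)] else [(0, j), (1, 1)]) \<and>
      surrounded ?G (if i = 0 then [(0, 1), (1, j)] else [(0, j), (1, 1)]) r"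
    using r by (auto simp: move_def surrounded_def parcs_grid_iff)
  then show "\<exists>cs. list_all2 (move ?G) ?cs cs \<and> surrounded ?G cs r" ..
qed (auto simp: pverts_grid)


text \<open>
  One cop holds the centre. When the other steps onto a robber at the middle \<open>a\<close> of a side, the
  robber has to flee to a corner next to \<open>a\<close>, where the first cop completes the surrounding.
\<close>

lemma two_cops_win_grid_3_3: "cops_win (path_graph 3 \<box> path_graph 3) 2"
proof -
  let ?G = "path_graph 3 \<box> path_graph 3" and ?c = "(1, 1) :: nat \<times> nat"
  let ?cs\<^sub>0 = "[?c, (0, 1)]"
  define sides :: "(nat \<times> nat) set" where "sides = {(0, 1), (1, 0), (1, 2), (2, 1)}"
  define corners :: "(nat \<times> nat) set" where "corners = {(0, 0), (0, 2), (2, 0), (2, 2)}"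
  \<comment> \<open>Both orders occur, since in \<open>rotate\<close> the side cop enters the centre
    while the centre cop leaves for the new side.\<close>
  define centred where "centred cs a \<longleftrightarrow> cs = [?c, a] \<or> cs = [a, ?c]" for cs a
  define J where "J cs r \<longleftrightarrow> (\<exists>a\<in>sides. centred cs a \<and>
      (r = a \<or> r \<in> corners \<and> (a, r) \<in> parcs ?G))" for cs r
  have verts: "pverts ?G = insert ?c (sides \<union> corners)"
    by (auto simp: pverts_grid sides_def corners_def less_Suc_eq numeral_eq_Suc)
  have c_side: "move ?G ?c a" "move ?G a ?c" if "a \<in> sides" for a
    using that by (auto simp: sides_def move_def parcs_grid_iff)
  have stay: "move ?G a a" for a
    by (simp add: move_def)
  have surround: "\<exists>cs'. list_all2 (move ?G) cs cs' \<and> surrounded ?G cs' r"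
    if "centred cs a" "a \<in> sides" "r \<in> corners" "(a, r) \<in> parcs ?G" for cs a r
  proof -
    have "\<exists>b\<in>sides. \<forall>v. (r, v) \<in> parcs ?G \<longrightarrow> v = a \<or> v = b"
    proof -
      obtain i j where r: "r = (i, j)" by (cases r)
      have nbr: "v = (i, 1) \<or> v = (1, j)" if "(r, v) \<in> parcs ?G \<or> (v, r) \<in> parcs ?G" for v
        using that \<open>r \<in> corners\<close> by (cases v) (auto simp: r corners_def parcs_grid_iff)
      have "{(i, 1), (1, j)} \<subseteq> sides"
        using \<open>r \<in> corners\<close> by (auto simp: r corners_def sides_def)
      with nbr that(4) show ?thesis by blast
    qed
    then obtain b where b: "b \<in> sides" "\<forall>v. (r, v) \<in> parcs ?G \<longrightarrow> v = a \<or> v = b" ..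
    from that(1) show ?thesis
    proof (unfold centred_def, elim disjE)
      assume "cs = [?c, a]"
      with b show ?thesis
        by (intro exI[of _ "[b, a]"]) (auto simp: surrounded_def c_side stay simp del: One_nat_def)
    next
      assume "cs = [a, ?c]"
      with b show ?thesis
        by (intro exI[of _ "[a, b]"]) (auto simp: surrounded_def c_side stay simp del: One_nat_def)
    qed
  qed
  have rotate: "\<exists>cs'. list_all2 (move ?G) cs cs' \<and> centred cs' b"
    if "centred cs a" "a \<in> sides" "b \<in> sides" for cs a b
    using that(1)
  proof (unfold centred_def, elim disjE)
    assume "cs = [?c, a]"
    with that show "\<exists>cs'. list_all2 (move ?G) cs cs' \<and> (cs' = [?c, b] \<or> cs' = [b, ?c])"
      by (intro exI[of _ "[b, ?c]"]) (auto simp: c_side simp del: One_nat_def)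
  next
    assume "cs = [a, ?c]"
    with that show "\<exists>cs'. list_all2 (move ?G) cs cs' \<and> (cs' = [?c, b] \<or> cs' = [b, ?c])"
      by (intro exI[of _ "[?c, b]"]) (auto simp: c_side simp del: One_nat_def)
  qed
  show ?thesis
  proof (rule cops_win_by_potential[where J = J and cs\<^sub>0 = ?cs\<^sub>0
        and \<Delta> = "measure (\<lambda>(cs, r). if r \<in> sides then 0 else 1)"])
    show "set ?cs\<^sub>0 \<subseteq> pverts ?G"
      by (simp add: pverts_grid)
  next
    fix r assume "r \<in> pverts ?G" "r \<notin> set ?cs\<^sub>0"
    then have "r \<in> sides \<or> r \<in> corners"
      by (auto simp: verts)
    then obtain a where a: "a \<in> sides" "r = a \<or> r \<in> corners \<and> (a, r) \<in> parcs ?G"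
      by (force simp: sides_def corners_def parcs_grid_iff)
    have "centred ?cs\<^sub>0 (0, 1)" "(0, 1) \<in> sides"
      by (simp_all add: centred_def sides_def)
    from rotate[OF this a(1)] a
    show "\<exists>cs. list_all2 (move ?G) ?cs\<^sub>0 cs \<and> (surrounded ?G cs r \<or> J cs r)"
      unfolding J_def by blast
  next
    fix cs r r' assume J: "J cs r" and mv: "move ?G r r'" and free: "r' \<notin> set cs"
    then obtain a where a: "a \<in> sides" "centred cs a" "r = a \<or> r \<in> corners \<and> (a, r) \<in> parcs ?G"
      unfolding J_def by blast
    have "r' \<noteq> a" "r' \<noteq> ?c"
      using a(2) free by (auto simp: centred_def)
    \<comment> \<open>A robber on \<open>a\<close> can flee only to an adjacent corner. From a
      corner he either rests and is surrounded, or moves to the side other than \<open>a\<close>;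
      there a cop steps onto him and the measure drops.\<close>
    with a(1,3) mv consider "r' \<in> corners" "(a, r') \<in> parcs ?G"
      | "r \<in> corners" "r \<notin> sides" "r' \<in> sides"
      by (cases r') (auto simp: sides_def corners_def move_def parcs_grid_iff)
    then show "\<exists>cs'. list_all2 (move ?G) cs cs' \<and> (surrounded ?G cs' r' \<or>
        J cs' r' \<and> ((cs', r'), (cs, r)) \<in> measure (\<lambda>(cs, r). if r \<in> sides then 0 else 1))"
    proof cases
      case 1
      with surround[OF a(2,1)] show ?thesis by blast
    next
      case 2
      then show ?thesis
        using rotate[OF a(2,1) 2(3)] by (auto simp: J_def)
    qed
  qed simp_all
qed

section \<open>Three cops on arbitrary grids\<close>

text \<open>
  A cop at \<open>(p, q)\<close> trails the robber at \<open>(x, y)\<close>: he first climbs the line \<open>p = 0\<close> until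
  \<open>q = y\<close>, then stays level with the robber while closing in on him from below in the first
  coordinate. On \<open>x = 0\<close> he may stand on the robber's vertex.
\<close>

definition trails :: "nat \<times> nat \<Rightarrow> nat \<times> nat \<Rightarrow> bool" where
  "trails = (\<lambda>(p, q) (x, y). p \<le> x \<and> q \<le> y \<and> (q < y \<longrightarrow> p = 0) \<and> (p < x \<or> x = 0))"

definition trail_step :: "nat \<times> nat \<Rightarrow> nat \<times> nat \<Rightarrow> nat \<times> nat" where
  "trail_step = (\<lambda>(p, q) (x, y).
     if q < y then (p, q + 1) else if y < q then (p, q - 1)
     else if p + 1 < x then (p + 1, q) else (p, q))"

text \<open>Measured against the border \<open>n\<close> rather than \<open>y\<close>: the robber
  can run away, but \<open>q\<close> grows in each round until the cop is level.\<close>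

definition lag :: "nat \<Rightarrow> nat \<times> nat \<Rightarrow> nat \<times> nat \<Rightarrow> nat" where
  "lag n = (\<lambda>(p, q) (x, y). if q < y then n - q else 0)"

text \<open>The cutoff at 1 treats a cop on the robber's vertex, possible at \<open>x = 0\<close>,
  like an adjacent one, so that leaving the line \<open>x = 0\<close> does not enlarge the
  gap.\<close>

definition gap :: "nat \<times> nat \<Rightarrow> nat \<times> nat \<Rightarrow> nat" where
  "gap = (\<lambda>(p, q) (x, y). max 1 (x - p))"

definition approach :: "nat \<times> nat \<Rightarrow> nat \<times> nat \<Rightarrow> nat \<times> nat" where
  "approach = (\<lambda>(p, q) (x, y).
     if p < x then (p + 1, q) else if x < p then (p - 1, q)
     else if q < y then (p, q + 1) else if y < q then (p, q - 1) else (p, q))"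

text \<open>Subtraction truncates, so each pair of opposite differences sums to an absolute
  difference.\<close>

definition taxicab :: "nat \<times> nat \<Rightarrow> nat \<times> nat \<Rightarrow> nat" where
  "taxicab = (\<lambda>(p, q) (x, y). (p - x) + (x - p) + (q - y) + (y - q))"

text \<open>The cop in the robber's row is a cop in his column of the transposed grid, so
  \<open>trail_step\<close> serves both.\<close>

lemma move_grid_swap:
  "move (path_graph n \<box> path_graph m) (prod.swap u) (prod.swap v) \<longleftrightarrow>
   move (path_graph m \<box> path_graph n) u v"
  by (cases u; cases v) (auto simp: move_def parcs_grid_iff)

text \<open>A level cop copies a sideways move, and its advance, or at \<open>x = 0\<close> the
  cutoff, offsets a move away. A move towards it shortens the gap: by \<open>c \<noteq> r'\<close>
  such a move starts from a gap above 1.\<close>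

lemma trail_step:
  assumes "trails c r" "move (path_graph m \<box> path_graph n) r r'" "c \<noteq> r'"
    "r \<in> {0..<m} \<times> {0..<n}"
  shows "trails (trail_step c r') r'"
    and "move (path_graph m \<box> path_graph n) c (trail_step c r')"
    and "lag n (trail_step c r') r' \<le> lag n c r"
    and "0 < lag n c r \<Longrightarrow> lag n (trail_step c r') r' < lag n c r"
    and "lag n c r = 0 \<Longrightarrow> gap (trail_step c r') r' \<le> gap c r"
    and "lag n c r = 0 \<Longrightarrow> fst r' < fst r \<Longrightarrow> gap (trail_step c r') r' < gap c r"
    and "lag n c r = 0 \<Longrightarrow> r' = r \<Longrightarrow> 1 < gap c r \<Longrightarrow> gap (trail_step c r') r' < gap c r"
proof -
  obtain p q x y x' y' where eqs: "c = (p, q)" "r = (x, y)" "r' = (x', y')"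
    by (metis surj_pair)
  have cop: "p \<le> x" "q \<le> y" "q < y \<Longrightarrow> p = 0" "p < x \<or> x = 0" "p < x' \<or> x' < p \<or> q \<noteq> y'"
    and rob: "x < m" "y < n" "x' < m" "y' < n"
      "x' = x \<and> (y' = y \<or> y' = Suc y \<or> y = Suc y') \<or> y' = y \<and> (x' = Suc x \<or> x = Suc x')"
    using assms by (auto simp: eqs trails_def move_def parcs_grid_iff)
  note defs = eqs trails_def trail_step_def lag_def gap_def move_def parcs_grid_iff
  consider "q < y'" "q < y" | "q < y'" "q = y" | "q = y'" "q < y" | "q = y'" "q = y" | "y' < q" "q = y"
    using cop(2) rob(5) by linarith
  note cases = this
  show "trails (trail_step c r') r'"
    using cases cop rob by cases (auto simp: defs)
  show "move (path_graph m \<box> path_graph n) c (trail_step c r')"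
    using cases cop rob by cases (auto simp: defs)
  show "lag n (trail_step c r') r' \<le> lag n c r"
    using cases cop rob by cases (auto simp: defs)
  show "lag n (trail_step c r') r' < lag n c r" if "0 < lag n c r"
    using cases cop rob that by cases (auto simp: defs)
  assume "lag n c r = 0"
  with cop rob have "q = y" by (auto simp: defs split: if_splits)
  show "gap (trail_step c r') r' \<le> gap c r"
    using \<open>q = y\<close> cop rob by (auto simp: defs)
  show "gap (trail_step c r') r' < gap c r" if "fst r' < fst r"
    using \<open>q = y\<close> cop rob that by (auto simp: defs)
  show "gap (trail_step c r') r' < gap c r" if "r' = r" "1 < gap c r"
    using \<open>q = y\<close> cop rob that by (auto simp: defs)
qed

lemma move_approach:
  assumes "c \<in> {0..<m} \<times> {0..<n}" "r \<in> {0..<m} \<times> {0..<n}"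
  shows "move (path_graph m \<box> path_graph n) c (approach c r)"
    and "approach c r \<in> {0..<m} \<times> {0..<n}"
  using assms
  by (cases c; cases r; auto simp: approach_def move_def parcs_grid_iff)+

lemma taxicab_approach:
  assumes "c \<noteq> r"
  shows "taxicab (approach c r) r < taxicab c r"
  using assms by (cases c; cases r) (auto simp: approach_def taxicab_def)


text \<open>Every round lowers a lexicographic measure, so no play lasts forever; the final
  surrounding need not be exhibited.\<close>

lemma three_cops_win_grid:
  assumes "0 < m" "0 < n"
  shows "cops_win (path_graph m \<box> path_graph n) 3"
proof -
  let ?G = "path_graph m \<box> path_graph n" and ?V = "{0..<m} \<times> {0..<n}"
  let ?cs\<^sub>0 = "[(0, 0), (0, 0), (0, 0)] :: (nat \<times> nat) list"
  define J where "J cs r \<longleftrightarrow> (\<exists>a c b. cs = [a, c, b] \<and> b \<in> ?V \<and> r \<in> ?V \<and>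
      trails a r \<and> trails (prod.swap c) (prod.swap r))" for cs r
  \<comment> \<open>In order of priority: time to alignment, distances of the aligned cops, the
    robber's distance from the far corner up to a constant, distance of the chaser.\<close>
  define \<mu>\<^sub>1 where "\<mu>\<^sub>1 = (\<lambda>(cs, r). lag n (cs ! 0) r + lag m (prod.swap (cs ! 1)) (prod.swap r))"
  define \<mu>\<^sub>2 where "\<mu>\<^sub>2 = (\<lambda>(cs, r). gap (cs ! 0) r + gap (prod.swap (cs ! 1)) (prod.swap r))"
  define \<mu>\<^sub>3 where "\<mu>\<^sub>3 = (\<lambda>(cs :: (nat \<times> nat) list, r). (m - fst r) + (n - snd r))"
  define \<mu>\<^sub>4 where "\<mu>\<^sub>4 = (\<lambda>(cs, r). taxicab (cs ! 2) r)"
  note \<mu>_defs = \<mu>\<^sub>1_def \<mu>\<^sub>2_def \<mu>\<^sub>3_def \<mu>\<^sub>4_def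
  \<comment> \<open>The cops \<open>a\<close> and \<open>c\<close> align themselves with the robber, and \<open>b\<close> chases him.\<close>
  show ?thesis
  proof (rule cops_win_by_potential[where J = J and cs\<^sub>0 = ?cs\<^sub>0 and \<Delta> = "measures [\<mu>\<^sub>1, \<mu>\<^sub>2, \<mu>\<^sub>3, \<mu>\<^sub>4]"])
    show "set ?cs\<^sub>0 \<subseteq> pverts ?G"
      using assms by (simp add: pverts_grid)
    \<comment> \<open>Cops in the corner \<open>(0, 0)\<close> trail every vertex in both
      orientations, so their first move is a pass.\<close>
    show "\<exists>cs. list_all2 (move ?G) ?cs\<^sub>0 cs \<and> (surrounded ?G cs r \<or> J cs r)"
      if "r \<in> pverts ?G" for r
      using that assms
      by (intro exI[of _ ?cs\<^sub>0]) (auto simp: J_def pverts_grid move_def trails_def)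
  next
    fix cs r r' assume "J cs r" and mv: "move ?G r r'" and free: "r' \<notin> set cs"
    then obtain a c b where cs: "cs = [a, c, b]" and b: "b \<in> ?V" and r: "r \<in> ?V"
      and a: "trails a r" and c: "trails (prod.swap c) (prod.swap r)"
      unfolding J_def by blast
    have r': "r' \<in> ?V"
      using r mv by (cases r; cases r') (auto simp: move_def parcs_grid_iff)
    have mv': "move (path_graph n \<box> path_graph m) (prod.swap r) (prod.swap r')"
      using mv by (simp add: move_grid_swap)
    have ne: "a \<noteq> r'" "prod.swap c \<noteq> prod.swap r'" "b \<noteq> r'"
      using free by (cases c; cases r'; auto simp: cs)+
    have rs: "prod.swap r \<in> {0..<n} \<times> {0..<m}"
      using r by auto
    define a' where "a' = trail_step a r'"
    define c' where "c' = prod.swap (trail_step (prod.swap c) (prod.swap r'))"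
    define b' where "b' = approach b r'"
    note A = trail_step[OF a mv ne(1) r, folded a'_def]
    have c'_swap: "trail_step (prod.swap c) (prod.swap r') = prod.swap c'"
      by (simp add: c'_def)
    note C = trail_step[OF c mv' ne(2) rs, unfolded c'_swap move_grid_swap]
    have B: "move ?G b b'" "b' \<in> ?V" "taxicab b' r' < taxicab b r'"
      unfolding b'_def by (fact move_approach[OF b r'] taxicab_approach[OF ne(3)])+
    have "(([a', c', b'], r'), (cs, r)) \<in> measures [\<mu>\<^sub>1, \<mu>\<^sub>2, \<mu>\<^sub>3, \<mu>\<^sub>4]"
    proof (cases "lag n a r = 0 \<and> lag m (prod.swap c) (prod.swap r) = 0")
      case False
      with A(3,4) C(3,4) have "\<mu>\<^sub>1 ([a', c', b'], r') < \<mu>\<^sub>1 (cs, r)"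
        by (auto simp: \<mu>_defs cs intro: add_less_le_mono add_le_less_mono)
      then show ?thesis by simp
    next
      case True
      then have le1: "\<mu>\<^sub>1 ([a', c', b'], r') \<le> \<mu>\<^sub>1 (cs, r)"
        using A(3) C(3) by (simp add: \<mu>_defs cs)
      have le2: "\<mu>\<^sub>2 ([a', c', b'], r') \<le> \<mu>\<^sub>2 (cs, r)"
        using A(5) C(5) True by (simp add: \<mu>_defs cs add_mono)
      \<comment> \<open>With both cops aligned, a step towards one lowers
        \<open>\<mu>\<^sub>2\<close>, and a step away lowers \<open>\<mu>\<^sub>3\<close> without
        raising \<open>\<mu>\<^sub>2\<close>. A rest lowers \<open>\<mu>\<^sub>2\<close> unless both
        gaps are 1; then the chaser's approach lowers \<open>\<mu>\<^sub>4\<close>.\<close>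
      consider (towards) "fst r' < fst r \<or> snd r' < snd r"
        | (away) "fst r < fst r' \<and> snd r = snd r' \<or> fst r = fst r' \<and> snd r < snd r'"
        | (rest) "r' = r"
        using mv by (cases r; cases r') (auto simp: move_def parcs_grid_iff)
      then show ?thesis
      proof cases
        case towards
        then have "\<mu>\<^sub>2 ([a', c', b'], r') < \<mu>\<^sub>2 (cs, r)"
          using A(5,6) C(5,6) True
          by (auto simp: \<mu>_defs cs intro: add_less_le_mono add_le_less_mono)
        with le1 show ?thesis by (auto simp: less_le)
      next
        case away
        then have "\<mu>\<^sub>3 ([a', c', b'], r') < \<mu>\<^sub>3 (cs, r)"
          using r r' by (auto simp: \<mu>_defs)
        with le1 le2 show ?thesis by (auto simp: less_le)
      next
        case rest
        show ?thesis
        proof (cases "1 < gap a r \<or> 1 < gap (prod.swap c) (prod.swap r)")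
          case gap: True
          then have "\<mu>\<^sub>2 ([a', c', b'], r') < \<mu>\<^sub>2 (cs, r)"
            using A(5,7) C(5,7) True rest
            by (auto simp: \<mu>_defs cs intro: add_less_le_mono add_le_less_mono)
          with le1 show ?thesis by (auto simp: less_le)
        next
          case False
          have "\<mu>\<^sub>3 ([a', c', b'], r') = \<mu>\<^sub>3 (cs, r)" "\<mu>\<^sub>4 ([a', c', b'], r') < \<mu>\<^sub>4 (cs, r)"
            using B(3) rest by (simp_all add: \<mu>_defs cs)
          with le1 le2 show ?thesis by (auto simp: less_le)
        qed
      qed
    qed
    moreover have "J [a', c', b'] r'"
      using A(1) C(1) B(2) r' by (auto simp: J_def)
    moreover have "list_all2 (move ?G) cs [a', c', b']"
      using A(2) C(2) B(1) by (simp add: cs)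
    ultimately show "\<exists>cs'. list_all2 (move ?G) cs cs' \<and> (surrounded ?G cs' r' \<or>
        J cs' r' \<and> ((cs', r'), (cs, r)) \<in> measures [\<mu>\<^sub>1, \<mu>\<^sub>2, \<mu>\<^sub>3, \<mu>\<^sub>4])"
      by blast
  qed simp_all
qed

theorem theorem17:
  fixes m n :: nat
  assumes "2 \<le> m" and "m \<le> n"
  shows "(m \<le> 3 \<and> n \<le> 3 \<longrightarrow> surrounding_cop_number (path_graph m \<box> path_graph n) = 2) \<and>
         (\<not> (m \<le> 3 \<and> n \<le> 3) \<longrightarrow> surrounding_cop_number (path_graph m \<box> path_graph n) = 3)"
proof (intro conjI impI)
  let ?G = "path_graph m \<box> path_graph n"
  have one: "\<not> cops_win ?G 1"
    using assms by (intro one_cop_loses_grid) auto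
  {
    assume "m \<le> 3 \<and> n \<le> 3"
    then have "m = 2 \<and> n = 2 \<or> m = 2 \<and> n = 3 \<or> m = 3 \<and> n = 3"
      using assms by linarith
    then have "cops_win ?G 2"
      using two_cops_win_grid_2_2 two_cops_win_grid_2_3 two_cops_win_grid_3_3 by blast
    then show "surrounding_cop_number ?G = 2"
      unfolding surrounding_cop_number_def
    proof (intro Least_equality)
      fix k assume "1 \<le> k \<and> cops_win ?G k"
      with one show "2 \<le> k" by (cases "k = 1") auto
    qed simp
  next
    assume "\<not> (m \<le> 3 \<and> n \<le> 3)"
    then have two: "\<not> cops_win ?G 2"
      using assms by (intro two_cops_lose_grid) auto
    have "cops_win ?G 3"
      using assms by (intro three_cops_win_grid) auto
    then show "surrounding_cop_number ?G = 3"
      unfolding surrounding_cop_number_def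
    proof (intro Least_equality)
      fix k assume "1 \<le> k \<and> cops_win ?G k"
      with one two show "3 \<le> k" by (cases "k = 1"; cases "k = 2") auto
    qed simp
  }
qed

end
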